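(* Let $N>3$ be an integer and let $\lambda\in\mathbb{R}$ be arbitrary. Let $x_i,y_i$ ($i\in\{0,\dots,N-1\}$) be canonical coordinates on $\mathbb{R}^{2N}$, equipped with the symplectic structure $\Omega=2\sum_{i=0}^{N-1}dx_i\wedge dy_i$, which leads to the Poisson bracket determined by $$\{x_i,y_i\}=\tfrac12,\qquad \text{all other brackets between coordinates being zero.}$$ Extend the coordinates periodically by $x_{k+N}:=x_k$, $y_{k+N}:=y_k$ for $k\in\mathbb{Z}$, and define, for $k\in\mathbb{Z}$, $$g_k:=x_ky_{k+1}-y_kx_{k+1},\qquad u_k:=x_{k-1}y_{k+1}-y_{k-1}x_{k+1},$$ $$a_k:=g_k^{-2},\qquad b_k:=\frac{u_k}{g_{k-1}g_k}-\lambda ,$$ on the open subset of $\mathbb{R}^{2N}$ where $g_k\neq0$ for all $k$. Then on this open subset, for all $k$ (indices modulo $N$), $$\{a_k,a_{k+1}\}=-2a_ka_{k+1}b_{k+1}-2a_ka_{k+1}\lambda,$$ $$\{b_k,b_{k+1}\}=-a_k(b_k+b_{k+1})-2a_k\lambda,$$ $$\{b_k,a_{k-2}\}=a_{k-2}a_{k-1},$$ $$\{b_k,a_{k-1}\}=a_{k-1}(b_k^2+a_{k-1})+2b_ka_{k-1}\lambda+a_{k-1}\lambda^2,$$ $$\{b_k,a_k\}=-a_k(b_k^2+a_k)-2b_ka_k\lambda-a_k\lambda^2,$$ $$\{b_k,a_{k+1}\}=-a_ka_{k+1},$$ and all remaining brackets among the $a_i,b_j$ (those not obtained from the listed ones by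 antisymmetry) are zero; that is, $\{a_k,a_l\}=0$ and $\{b_k,b_l\}=0$ whenever $l\not\equiv k\pm1 \pmod N$, and $\{b_k,a_l\}=0$ whenever $l\not\equiv k-2,k-1,k,k+1\pmod N$. Moreover, for each power of $\lambda$ the coefficients in these relations give one of the three Poisson brackets of the periodic Toda lattice hierarchy: on the generators $a_k,b_k$, $$\{\cdot,\cdot\}=\{\cdot,\cdot\}_3+2\lambda\,\{\cdot,\cdot\}_2+\lambda^2\,\{\cdot,\cdot\}_1,$$ where $\{\cdot,\cdot\}_1,\{\cdot,\cdot\}_2,\{\cdot,\cdot\}_3$ are the linear, quadratic and cubic Toda brackets.
   Context: The three (linear, quadratic, cubic) Poisson brackets of the $N$-periodic Toda lattice hierarchy in the Flaschka-Manakov variables $a_k,b_k$ (indices modulo $N$, $N>3$) are given by the following relations, where all brackets of generators not listed (and not obtained from the listed ones by antisymmetry) are zero. Linear: $\{b_k,a_k\}_1=-a_k$, $\{b_k,a_{k-1}\}_1=a_{k-1}$. Quadratic: $\{a_k,a_{k+1}\}_2=-a_ka_{k+1}$, $\{b_k,b_{k+1}\}_2=-a_k$, $\{b_k,a_k\}_2=-b_ka_k$, $\{b_k,a_{k-1}\}_2=b_ka_{k-1}$. Cubic: $\{a_k,a_{k+1}\}_3=-2a_ka_{k+1}b_{k+1}$, $\{b_k,b_{k+1}\}_3=-a_k(b_k+b_{k+1})$, $\{b_k,a_{k-2}\}_3=a_{k-2}a_{k-1}$, $\{b_k,a_{k-1}\}_3=a_{k-1}(b_k^2+a_{k-1})$,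 $\{b_k,a_k\}_3=-a_k(b_k^2+a_k)$, $\{b_k,a_{k+1}\}_3=-a_ka_{k+1}$. The Poisson bracket on $\mathbb{R}^{2N}$ is, explicitly, $\{f,h\}=\frac12\sum_{i=0}^{N-1}\left(\frac{\partial f}{\partial x_i}\frac{\partial h}{\partial y_i}-\frac{\partial f}{\partial y_i}\frac{\partial h}{\partial x_i}\right)$. *)

theory Defs
  imports "HOL-Analysis.Analysis" "Berlekamp_Zassenhaus.Finite_Field"
begin

text \<open>
  The index type is \<open>'n mod_ring\<close>, i.e. the ring Z/N with N = CARD('n). A vector in
  \<open>real ^ 'n mod_ring\<close> is thus a family of N reals that is automatically extended N-periodically:
  index arithmetic such as \<open>k + 1\<close> is arithmetic modulo N.
\<close>

type_synonym 'i pairs = "(real ^ 'i) \<times> (real ^ 'i)"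

definition partial1 :: "'i::finite \<Rightarrow> ('i pairs \<Rightarrow> real) \<Rightarrow> 'i pairs \<Rightarrow> real" where
  "partial1 i f p = deriv (\<lambda>t. f (fst p + t *\<^sub>R axis i 1, snd p)) 0"

definition partial2 :: "'i::finite \<Rightarrow> ('i pairs \<Rightarrow> real) \<Rightarrow> 'i pairs \<Rightarrow> real" where
  "partial2 i f p = deriv (\<lambda>t. f (fst p, snd p + t *\<^sub>R axis i 1)) 0"

text \<open>
  The factor 1/2 comes from the symplectic form \<open>2 \<Sum>\<^sub>i dx\<^sub>i \<and> dy\<^sub>i\<close>.
\<close>

definition poisson :: "('i::finite pairs \<Rightarrow> real) \<Rightarrow> ('i pairs \<Rightarrow> real) \<Rightarrow> 'i pairs \<Rightarrow> real" where
  "poisson f h z =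
     (1/2) * (\<Sum>i\<in>UNIV. partial1 i f z * partial2 i h z - partial2 i f z * partial1 i h z)"

definition g_fun :: "'i::{finite,comm_ring_1} \<Rightarrow> 'i pairs \<Rightarrow> real" where
  "g_fun k = (\<lambda>(x, y). x $ k * y $ (k + 1) - y $ k * x $ (k + 1))"

definition u_fun :: "'i::{finite,comm_ring_1} \<Rightarrow> 'i pairs \<Rightarrow> real" where
  "u_fun k = (\<lambda>(x, y). x $ (k - 1) * y $ (k + 1) - y $ (k - 1) * x $ (k + 1))"

definition a_fun :: "'i::{finite,comm_ring_1} \<Rightarrow> 'i pairs \<Rightarrow> real" where
  "a_fun k z = g_fun k z powi (- 2)"

definition b_fun :: "real \<Rightarrow> 'i::{finite,comm_ring_1} \<Rightarrow> 'i pairs \<Rightarrow> real" where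
  "b_fun lam k z = u_fun k z / (g_fun (k - 1) z * g_fun k z) - lam"

definition regular_set :: "'i::{finite,comm_ring_1} pairs set" where
  "regular_set = {z. \<forall>k. g_fun k z \<noteq> 0}"

definition flaschka_map :: "real \<Rightarrow> 'i::{finite,comm_ring_1} pairs \<Rightarrow> 'i pairs" where
  "flaschka_map lam z = ((\<chi> k. a_fun k z), (\<chi> k. b_fun lam k z))"

definition a_coord :: "'i \<Rightarrow> 'i::finite pairs \<Rightarrow> real" where
  "a_coord k w = fst w $ k"

definition b_coord :: "'i \<Rightarrow> 'i::finite pairs \<Rightarrow> real" where
  "b_coord k w = snd w $ k"

definition toda_generators :: "('i::finite pairs \<Rightarrow> real) set" where
  "toda_generators = range a_coord \<union> range b_coord"

text \<open>
  The Poisson bracket of functions of \<open>(a, b)\<close> determined by the brackets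
  \<open>AA k l = {a\<^sub>k, a\<^sub>l}\<close>, \<open>BB k l = {b\<^sub>k, b\<^sub>l}\<close>, \<open>BA k l = {b\<^sub>k, a\<^sub>l}\<close> of the generators through
  bilinearity, the Leibniz rule and \<open>{a\<^sub>l, b\<^sub>k} = - {b\<^sub>k, a\<^sub>l}\<close>. The tables AA and BB supplied
  below are antisymmetric.
\<close>

definition bracket_of_table ::
  "('i \<Rightarrow> 'i \<Rightarrow> 'i pairs \<Rightarrow> real) \<Rightarrow> ('i \<Rightarrow> 'i \<Rightarrow> 'i pairs \<Rightarrow> real) \<Rightarrow> ('i \<Rightarrow> 'i \<Rightarrow> 'i pairs \<Rightarrow> real) \<Rightarrow>
   ('i::finite pairs \<Rightarrow> real) \<Rightarrow> ('i pairs \<Rightarrow> real) \<Rightarrow> 'i pairs \<Rightarrow> real" where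
  "bracket_of_table AA BB BA F H w = (\<Sum>k\<in>UNIV. \<Sum>l\<in>UNIV.
       AA k l w * partial1 k F w * partial1 l H w
     + BB k l w * partial2 k F w * partial2 l H w
     + BA k l w * (partial2 k F w * partial1 l H w - partial1 l F w * partial2 k H w))"

text \<open>
  In the tables a point is a pair \<open>(a, b)\<close>. For N > 3 the conditions tested in each table are
  mutually exclusive, so the order of the case distinctions is irrelevant.
\<close>

definition toda1_BA :: "'i \<Rightarrow> 'i \<Rightarrow> 'i::{finite,comm_ring_1} pairs \<Rightarrow> real" where
  "toda1_BA k l = (\<lambda>(a, b).
     if l = k then - a $ k
     else if l = k - 1 then a $ (k - 1)
     else 0)"

definition toda2_AA :: "'i \<Rightarrow> 'i \<Rightarrow> 'i::{finite,comm_ring_1} pairs \<Rightarrow> real" where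
  "toda2_AA k l = (\<lambda>(a, b).
     if l = k + 1 then - a $ k * a $ (k + 1)
     else if k = l + 1 then a $ l * a $ (l + 1)
     else 0)"

definition toda2_BB :: "'i \<Rightarrow> 'i \<Rightarrow> 'i::{finite,comm_ring_1} pairs \<Rightarrow> real" where
  "toda2_BB k l = (\<lambda>(a, b).
     if l = k + 1 then - a $ k
     else if k = l + 1 then a $ l
     else 0)"

definition toda2_BA :: "'i \<Rightarrow> 'i \<Rightarrow> 'i::{finite,comm_ring_1} pairs \<Rightarrow> real" where
  "toda2_BA k l = (\<lambda>(a, b).
     if l = k then - b $ k * a $ k
     else if l = k - 1 then b $ k * a $ (k - 1)
     else 0)"

definition toda3_AA :: "'i \<Rightarrow> 'i \<Rightarrow> 'i::{finite,comm_ring_1} pairs \<Rightarrow> real" where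
  "toda3_AA k l = (\<lambda>(a, b).
     if l = k + 1 then - 2 * a $ k * a $ (k + 1) * b $ (k + 1)
     else if k = l + 1 then 2 * a $ l * a $ (l + 1) * b $ (l + 1)
     else 0)"

definition toda3_BB :: "'i \<Rightarrow> 'i \<Rightarrow> 'i::{finite,comm_ring_1} pairs \<Rightarrow> real" where
  "toda3_BB k l = (\<lambda>(a, b).
     if l = k + 1 then - a $ k * (b $ k + b $ (k + 1))
     else if k = l + 1 then a $ l * (b $ l + b $ (l + 1))
     else 0)"

definition toda3_BA :: "'i \<Rightarrow> 'i \<Rightarrow> 'i::{finite,comm_ring_1} pairs \<Rightarrow> real" where
  "toda3_BA k l = (\<lambda>(a, b).
     if l = k - 2 then a $ (k - 2) * a $ (k - 1)
     else if l = k - 1 then a $ (k - 1) * ((b $ k)\<^sup>2 + a $ (k - 1))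
     else if l = k then - a $ k * ((b $ k)\<^sup>2 + a $ k)
     else if l = k + 1 then - a $ k * a $ (k + 1)
     else 0)"

definition toda_bracket1 ::
  "('i::{finite,comm_ring_1} pairs \<Rightarrow> real) \<Rightarrow> ('i pairs \<Rightarrow> real) \<Rightarrow> 'i pairs \<Rightarrow> real" where
  "toda_bracket1 = bracket_of_table (\<lambda>k l w. 0) (\<lambda>k l w. 0) toda1_BA"

definition toda_bracket2 ::
  "('i::{finite,comm_ring_1} pairs \<Rightarrow> real) \<Rightarrow> ('i pairs \<Rightarrow> real) \<Rightarrow> 'i pairs \<Rightarrow> real" where
  "toda_bracket2 = bracket_of_table toda2_AA toda2_BB toda2_BA"

definition toda_bracket3 ::
  "('i::{finite,comm_ring_1} pairs \<Rightarrow> real) \<Rightarrow> ('i pairs \<Rightarrow> real) \<Rightarrow> 'i pairs \<Rightarrow> real" where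
  "toda_bracket3 = bracket_of_table toda3_AA toda3_BB toda3_BA"

lemma partial_coord:
  "partial1 i (a_coord k) w = (if i = k then 1 else 0)"
  "partial2 i (a_coord k) w = 0"
  "partial1 i (b_coord k) w = 0"
  "partial2 i (b_coord k) w = (if i = k then 1 else 0)"
proof -
  have 1: "deriv (\<lambda>t. c + t * d) 0 = d" for c d :: real
    by (rule DERIV_imp_deriv) (auto intro!: derivative_eq_intros)
  show "partial1 i (a_coord k) w = (if i = k then 1 else 0)"
    "partial2 i (b_coord k) w = (if i = k then 1 else 0)"
    by (simp_all only: partial1_def partial2_def a_coord_def b_coord_def fst_conv snd_conv
        vector_add_component vector_scaleR_component real_scaleR_def 1)
      (simp_all add: axis_def eq_commute)
  show "partial2 i (a_coord k) w = 0" "partial1 i (b_coord k) w = 0"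
    by (simp_all add: partial1_def partial2_def a_coord_def b_coord_def)
qed

lemma poisson_coord:
  "poisson (\<lambda>(x, y). x $ i) (\<lambda>(x, y). y $ j) z = (if i = j then 1/2 else 0)"
  "poisson (\<lambda>(x, y). x $ i) (\<lambda>(x, y). x $ j) z = 0"
  "poisson (\<lambda>(x, y). y $ i) (\<lambda>(x, y). y $ j) z = 0"
proof -
  have eq: "(\<lambda>(x, y). x $ k) = a_coord k" "(\<lambda>(x, y). y $ k) = b_coord k" for k :: 'a
    by (simp_all add: a_coord_def b_coord_def fun_eq_iff)
  have "(\<Sum>m\<in>UNIV. (if m = i then 1 else 0) * (if m = j then 1 else 0))
      = (\<Sum>m\<in>UNIV. if m = i then if i = j then 1 else 0 else (0::real))"
    by (rule sum.cong) auto
  then show "poisson (\<lambda>(x, y). x $ i) (\<lambda>(x, y). y $ j) z = (if i = j then 1/2 else 0)"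
    by (simp add: eq poisson_def partial_coord)
  show "poisson (\<lambda>(x, y). x $ i) (\<lambda>(x, y). x $ j) z = 0"
    "poisson (\<lambda>(x, y). y $ i) (\<lambda>(x, y). y $ j) z = 0"
    by (simp_all add: eq poisson_def partial_coord)
qed

lemma bracket_of_table_coord:
  "bracket_of_table AA BB BA (a_coord k) (a_coord l) w = AA k l w"
  "bracket_of_table AA BB BA (b_coord k) (b_coord l) w = BB k l w"
  "bracket_of_table AA BB BA (b_coord k) (a_coord l) w = BA k l w"
  "bracket_of_table AA BB BA (a_coord l) (b_coord k) w = - BA k l w"
proof -
  define d :: "'a \<Rightarrow> 'a \<Rightarrow> real" where "d i k = (if i = k then 1 else 0)" for i k
  have pc: "partial1 i (a_coord k) w = d i k" "partial2 i (b_coord k) w = d i k"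
    "partial2 i (a_coord k) w = 0" "partial1 i (b_coord k) w = 0" for i k
    by (simp_all add: partial_coord d_def)
  have *: "(\<Sum>i\<in>UNIV. \<Sum>j\<in>UNIV. f i j * (d i k * d j l)) = f k l" for f k l
  proof -
    have "(\<Sum>j\<in>UNIV. f i j * (d i k * d j l)) = (\<Sum>j\<in>UNIV. if j = l then f i l * d i k else 0)" for i
      by (rule sum.cong) (auto simp: d_def)
    then have "(\<Sum>j\<in>UNIV. f i j * (d i k * d j l)) = (if i = k then f k l else 0)" for i
      by (simp add: d_def)
    then show ?thesis by simp
  qed
  show "bracket_of_table AA BB BA (a_coord k) (a_coord l) w = AA k l w"
    using *[of "\<lambda>k l. AA k l w"] by (simp add: bracket_of_table_def pc mult.assoc)
  show "bracket_of_table AA BB BA (b_coord k) (b_coord l) w = BB k l w"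
    using *[of "\<lambda>k l. BB k l w"] by (simp add: bracket_of_table_def pc mult.assoc)
  show "bracket_of_table AA BB BA (b_coord k) (a_coord l) w = BA k l w"
    using *[of "\<lambda>k l. BA k l w"] by (simp add: bracket_of_table_def pc)
  show "bracket_of_table AA BB BA (a_coord l) (b_coord k) w = - BA k l w"
    using *[of "\<lambda>k l. - BA k l w"] by (simp add: bracket_of_table_def pc mult.commute)
qed

lemma open_regular_set: "open (regular_set :: 'i::{finite,comm_ring_1} pairs set)"
proof -
  have eq: "regular_set = (\<Inter>k. {z :: 'i pairs. g_fun k z \<noteq> 0})"
    by (auto simp: regular_set_def)
  have "open {z :: 'i pairs. g_fun k z \<noteq> 0}" for k
    unfolding g_fun_def case_prod_beta by (intro open_Collect_neq continuous_intros)
  then show ?thesis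
    unfolding eq by (intro open_INT) auto
qed

end

theory Submission
  imports Defs
begin

text \<open>
  Write \<open>r\<^sub>i = (x\<^sub>i, y\<^sub>i)\<close>. As a function of an outer vector \<open>r\<^sub>k\<^sub>+\<^sub>1\<close> (or \<open>r\<^sub>k\<^sub>-\<^sub>1\<close>), the quotient defining
  \<open>b\<^sub>k\<close> is homogeneous of degree 0, so its gradient there is orthogonal to that vector; the
  proportionality factor is \<open>a\<^sub>k\<close> (or \<open>- a\<^sub>k\<^sub>-\<^sub>1\<close>). Hence two functions \<open>b\<^sub>k\<close>, \<open>b\<^sub>l\<close> that share only
  outer vectors commute, even if they share two of them as for \<open>N = 4\<close>, \<open>l = k + 2\<close>. The other
  brackets are sums over at most two shared vectors.
\<close>

section \<open>Gradients of \<open>g\<^sub>k\<close>, \<open>u\<^sub>k\<close>,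
  \<open>a\<^sub>k\<close> and \<open>b\<^sub>k\<close>\<close>

definition delta :: "'i \<Rightarrow> 'i \<Rightarrow> real" where
  "delta i j = (if i = j then 1 else 0)"

lemma delta_simps [simp]: "delta i i = 1" "i \<noteq> j \<Longrightarrow> delta i j = 0"
  by (simp_all add: delta_def)

lemma axis_nth_delta: "axis i (1::real) $ j = delta i j"
  by (simp add: axis_def delta_def)

lemma g_fun_nonzero: "z \<in> regular_set \<Longrightarrow> g_fun k z \<noteq> 0"
  by (simp add: regular_set_def)

lemma has_derivative_g_fun:
  "((\<lambda>t. g_fun k (x + t *\<^sub>R axis i 1, y)) has_real_derivative
      delta i k * y $ (k + 1) - y $ k * delta i (k + 1)) (at 0)"
  "((\<lambda>t. g_fun k (x, y + t *\<^sub>R axis i 1)) has_real_derivative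
      x $ k * delta i (k + 1) - delta i k * x $ (k + 1)) (at 0)"
  unfolding g_fun_def case_prod_conv vector_add_component vector_scaleR_component axis_nth_delta
    real_scaleR_def
  by (auto intro!: derivative_eq_intros)

lemma has_derivative_u_fun:
  "((\<lambda>t. u_fun k (x + t *\<^sub>R axis i 1, y)) has_real_derivative
      delta i (k - 1) * y $ (k + 1) - y $ (k - 1) * delta i (k + 1)) (at 0)"
  "((\<lambda>t. u_fun k (x, y + t *\<^sub>R axis i 1)) has_real_derivative
      x $ (k - 1) * delta i (k + 1) - delta i (k - 1) * x $ (k + 1)) (at 0)"
  unfolding u_fun_def case_prod_conv vector_add_component vector_scaleR_component axis_nth_delta
    real_scaleR_def
  by (auto intro!: derivative_eq_intros)

lemma a_fun_eq: "a_fun k z = 1 / (g_fun k z)\<^sup>2"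
  by (simp add: a_fun_def power_int_minus field_simps)

lemma b_fun_add: "b_fun lam k z + lam = u_fun k z / (g_fun (k - 1) z * g_fun k z)"
  by (simp add: b_fun_def)

lemma partial_a_fun:
  assumes "g_fun k (x, y) \<noteq> 0"
  shows "partial1 i (a_fun k) (x, y)
      = - 2 * (delta i k * y $ (k + 1) - y $ k * delta i (k + 1)) / g_fun k (x, y) ^ 3"
    and "partial2 i (a_fun k) (x, y)
      = - 2 * (x $ k * delta i (k + 1) - delta i k * x $ (k + 1)) / g_fun k (x, y) ^ 3"
proof -
  have inv_sq: "((\<lambda>t. 1 / (f t)\<^sup>2) has_real_derivative - 2 * D / f 0 ^ 3) (at 0)"
    if "(f has_real_derivative D) (at 0)" "f 0 \<noteq> 0" for f D
    using that by (auto intro!: derivative_eq_intros simp: field_simps power_numeral_reduce)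
  show "partial1 i (a_fun k) (x, y)
      = - 2 * (delta i k * y $ (k + 1) - y $ k * delta i (k + 1)) / g_fun k (x, y) ^ 3"
    unfolding partial1_def fst_conv snd_conv a_fun_eq
    using inv_sq[OF has_derivative_g_fun(1)[of k x i y]] assms by (intro DERIV_imp_deriv) simp
  show "partial2 i (a_fun k) (x, y)
      = - 2 * (x $ k * delta i (k + 1) - delta i k * x $ (k + 1)) / g_fun k (x, y) ^ 3"
    unfolding partial2_def fst_conv snd_conv a_fun_eq
    using inv_sq[OF has_derivative_g_fun(2)[of k x y i]] assms by (intro DERIV_imp_deriv) simp
qed

text \<open>The two indices differ by 2. They are the outer indices of \<open>b\<^sub>k\<close>, and
  their being distinct keeps the two outer contributions to its gradient apart.\<close>

lemma add_one_neq_diff_one: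
  assumes "(2::'i::{finite,comm_ring_1}) \<noteq> 0"
  shows "k + 1 \<noteq> k - (1::'i)" "k - 1 \<noteq> k + (1::'i)"
  using assms by (simp_all add: eq_diff_eq diff_eq_eq add.assoc)

text \<open>At \<open>i = k\<close> the numerator \<open>U\<close> is constant and only the two
  denominators contribute. At an outer index one denominator is constant, and the identity \<open>G
  r\<^sub>k\<^sub>+\<^sub>1 - U r\<^sub>k + H r\<^sub>k\<^sub>-\<^sub>1 = 0\<close>, which holds for
  any three plane vectors and their pairwise determinants, collapses the quotient rule to a single
  term.\<close>

lemma partial_b_fun:
  fixes x y :: "real ^ 'i::{finite,comm_ring_1}"
  assumes "g_fun (k - 1) (x, y) \<noteq> 0" "g_fun k (x, y) \<noteq> 0" and two: "(2::'i) \<noteq> 0"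
  shows "partial1 i (b_fun lam k) (x, y) =
      delta i (k + 1) * a_fun k (x, y) * y $ (k + 1)
      - delta i (k - 1) * a_fun (k - 1) (x, y) * y $ (k - 1)
      + delta i k * (b_fun lam k (x, y) + lam)
          * (y $ (k - 1) / g_fun (k - 1) (x, y) - y $ (k + 1) / g_fun k (x, y))"
      (is "_ = ?X")
    and "partial2 i (b_fun lam k) (x, y) =
      - delta i (k + 1) * a_fun k (x, y) * x $ (k + 1)
      + delta i (k - 1) * a_fun (k - 1) (x, y) * x $ (k - 1)
      - delta i k * (b_fun lam k (x, y) + lam)
          * (x $ (k - 1) / g_fun (k - 1) (x, y) - x $ (k + 1) / g_fun k (x, y))"
      (is "_ = ?Y")
proof -
  define G H U where "G = g_fun (k - 1) (x, y)" and "H = g_fun k (x, y)" and "U = u_fun k (x, y)"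
  have nz: "G \<noteq> 0" "H \<noteq> 0" using assms by (simp_all add: G_def H_def)
  have GHU: "G = x $ (k - 1) * y $ k - y $ (k - 1) * x $ k" "H = x $ k * y $ (k + 1) - y $ k * x $ (k + 1)"
    "U = x $ (k - 1) * y $ (k + 1) - y $ (k - 1) * x $ (k + 1)"
    by (simp_all add: G_def H_def U_def g_fun_def u_fun_def)
  note ne = add_one_neq_diff_one[OF two, of k]
  \<comment> \<open>Differentiating the denominators logarithmically keeps the factor
    \<open>u 0 / (g 0 * h 0)\<close> visible; in the application it equals
    \<open>b_fun lam k (x, y) + lam\<close>.\<close>
  have quot: "((\<lambda>t. u t / (g t * h t) - lam) has_real_derivative
      Du / (g 0 * h 0) - u 0 / (g 0 * h 0) * (Dg / g 0 + Dh / h 0)) (at 0)"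
    if "(u has_real_derivative Du) (at 0)" "(g has_real_derivative Dg) (at 0)"
      "(h has_real_derivative Dh) (at 0)" "g 0 \<noteq> 0" "h 0 \<noteq> 0" for u g h Du Dg Dh
    using that by (auto intro!: derivative_eq_intros simp: field_simps)
  \<comment> \<open>This serves \<open>i = k + 1\<close>, where
    \<open>g\<^sub>k\<^sub>-\<^sub>1\<close> does not vary. The premise is one coordinate of the
    three-vector identity; it lets \<open>G\<close> cancel, and the remaining
    \<open>1 / H\<^sup>2\<close> is \<open>a\<^sub>k\<close>. The fact \<open>left\<close> is its
    mirror image.\<close>
  have right: "Du / (G * H) - U / (G * H) * (Dh / H) = v / H\<^sup>2"
    if "Du * H - U * Dh = G * v" for Du Dh v
  proof -
    have "Du / (G * H) - U / (G * H) * (Dh / H) = (Du * H - U * Dh) / (G * H\<^sup>2)"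
      using nz by (simp add: field_simps power2_eq_square)
    then show ?thesis using nz by (simp add: that)
  qed
  have left: "Du / (G * H) - U / (G * H) * (Dg / G) = v / G\<^sup>2"
    if "Du * G - U * Dg = H * v" for Du Dg v
  proof -
    have "Du / (G * H) - U / (G * H) * (Dg / G) = (Du * G - U * Dg) / (H * G\<^sup>2)"
      using nz by (simp add: field_simps power2_eq_square)
    then show ?thesis using nz by (simp add: that)
  qed
  let ?D = "\<lambda>Du Dg Dh. Du / (G * H) - U / (G * H) * (Dg / G + Dh / H)"
  have "partial1 i (b_fun lam k) (x, y) = ?D
      (delta i (k - 1) * y $ (k + 1) - y $ (k - 1) * delta i (k + 1))
      (delta i (k - 1) * y $ k - y $ (k - 1) * delta i k)
      (delta i k * y $ (k + 1) - y $ k * delta i (k + 1))"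
    unfolding partial1_def fst_conv snd_conv b_fun_def
    using nz quot[OF has_derivative_u_fun(1)[of k x i y] has_derivative_g_fun(1)[of "k-1" x i y]
        has_derivative_g_fun(1)[of k x i y]]
    by (intro DERIV_imp_deriv) (simp add: G_def H_def U_def)
  also have "\<dots> = ?X"
  proof -
    consider "i = k + 1" | "i = k - 1" | "i = k" | "i \<noteq> k + 1" "i \<noteq> k - 1" "i \<noteq> k" by blast
    then show ?thesis
    proof cases
      case 1
      have "- y $ (k - 1) * H - U * (- y $ k) = G * y $ (k + 1)"
        unfolding GHU by (simp add: algebra_simps)
      from right[OF this] show ?thesis
        using 1 ne by (simp add: a_fun_eq flip: G_def H_def)
    next
      case 2
      have "y $ (k + 1) * G - U * y $ k = H * (- y $ (k - 1))"
        unfolding GHU by (simp add: algebra_simps)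
      from left[OF this] show ?thesis
        using 2 ne by (simp add: a_fun_eq flip: G_def H_def)
    next
      case 3
      then show ?thesis
        using nz by (simp add: b_fun_add flip: G_def H_def U_def) (simp add: field_simps)
    qed simp
  qed
  finally show "partial1 i (b_fun lam k) (x, y) = ?X" .
  have "partial2 i (b_fun lam k) (x, y) = ?D
      (x $ (k - 1) * delta i (k + 1) - delta i (k - 1) * x $ (k + 1))
      (x $ (k - 1) * delta i k - delta i (k - 1) * x $ k)
      (x $ k * delta i (k + 1) - delta i k * x $ (k + 1))"
    unfolding partial2_def fst_conv snd_conv b_fun_def
    using nz quot[OF has_derivative_u_fun(2)[of k x y i] has_derivative_g_fun(2)[of "k-1" x y i]
        has_derivative_g_fun(2)[of k x y i]]
    by (intro DERIV_imp_deriv) (simp add: G_def H_def U_def)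
  also have "\<dots> = ?Y"
  proof -
    consider "i = k + 1" | "i = k - 1" | "i = k" | "i \<noteq> k + 1" "i \<noteq> k - 1" "i \<noteq> k" by blast
    then show ?thesis
    proof cases
      case 1
      have "x $ (k - 1) * H - U * x $ k = G * (- x $ (k + 1))"
        unfolding GHU by (simp add: algebra_simps)
      from right[OF this] show ?thesis
        using 1 ne by (simp add: a_fun_eq flip: G_def H_def)
    next
      case 2
      have "- x $ (k + 1) * G - U * (- x $ k) = H * x $ (k - 1)"
        unfolding GHU by (simp add: algebra_simps)
      from left[OF this] show ?thesis
        using 2 ne by (simp add: a_fun_eq flip: G_def H_def)
    next
      case 3
      then show ?thesis
        using nz by (simp add: b_fun_add flip: G_def H_def U_def)
    qed simp
  qed
  finally show "partial2 i (b_fun lam k) (x, y) = ?Y" .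
qed

lemma partial_a_fun_zero:
  assumes "z \<in> regular_set" "i \<notin> {k, k + 1}"
  shows "partial1 i (a_fun k) z = 0" "partial2 i (a_fun k) z = 0"
  using assms partial_a_fun[of k "fst z" "snd z" i] g_fun_nonzero[of z k] by auto

lemma partial_b_fun_zero:
  fixes z :: "'i::{finite,comm_ring_1} pairs"
  assumes "z \<in> regular_set" "(2::'i) \<noteq> 0" "i \<notin> {k - 1, k, k + 1}"
  shows "partial1 i (b_fun lam k) z = 0" "partial2 i (b_fun lam k) z = 0"
  using assms partial_b_fun[of k "fst z" "snd z" i lam] g_fun_nonzero[of z] by auto

text \<open>Away from its centre the gradient of \<open>b\<^sub>k\<close> is parallel to
  \<open>(y\<^sub>i, - x\<^sub>i)\<close>, a direction that does not depend on \<open>k\<close>. Two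
  such gradients therefore contribute nothing to a bracket.\<close>

lemma partial_b_fun_outer:
  fixes z :: "'i::{finite,comm_ring_1} pairs"
  assumes "z \<in> regular_set" "(2::'i) \<noteq> 0" "i \<noteq> k"
  obtains c where "partial1 i (b_fun lam k) z = c * snd z $ i"
    "partial2 i (b_fun lam k) z = - c * fst z $ i"
proof -
  define c where "c = (if i = k + 1 then a_fun k z else if i = k - 1 then - a_fun (k - 1) z else 0)"
  have "partial1 i (b_fun lam k) z = c * snd z $ i" "partial2 i (b_fun lam k) z = - c * fst z $ i"
    using partial_b_fun[of k "fst z" "snd z" i lam] g_fun_nonzero[OF assms(1)] assms(2,3)
      add_one_neq_diff_one[OF assms(2), of k]
    by (auto simp: c_def)
  then show thesis by (rule that)
qed

section \<open>Brackets of the functions \<open>a\<^sub>k\<close> and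
  \<open>b\<^sub>k\<close>\<close>

lemma poisson_swap: "poisson h f z = - poisson f h z"
  by (simp add: poisson_def algebra_simps flip: sum_negf)

text \<open>A vector contributes only if both functions depend on it. This turns a sum over all
  indices into one over an explicit set of one or two indices, whatever the size of the index
  type.\<close>

lemma poisson_eq_sum:
  assumes "\<And>i. i \<notin> S \<Longrightarrow> partial1 i f z = 0 \<and> partial2 i f z = 0 \<or> partial1 i h z = 0 \<and> partial2 i h z = 0"
  shows "poisson f h z = (1/2) * (\<Sum>i\<in>S. partial1 i f z * partial2 i h z - partial2 i f z * partial1 i h z)"
  unfolding poisson_def using assms
  by (intro arg_cong[of _ _ "(*) (1/2)"] sum.mono_neutral_right) fastforce+

lemma poisson_eq_zero:
  assumes "\<And>i. partial1 i f z = 0 \<and> partial2 i f z = 0 \<or> partial1 i h z = 0 \<and> partial2 i h z = 0"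
  shows "poisson f h z = 0"
  using assms poisson_eq_sum[of "{}" f z h] by simp

lemma poisson_nonneighbours:
  fixes z :: "'i::{finite,comm_ring_1} pairs"
  assumes z: "z \<in> regular_set" and two: "(2::'i) \<noteq> 0"
  shows "l \<notin> {k - 1, k + 1} \<Longrightarrow> poisson (a_fun k) (a_fun l) z = 0"
    and "l \<notin> {k - 1, k + 1} \<Longrightarrow> poisson (b_fun lam k) (b_fun lam l) z = 0"
    and "l \<notin> {k - 2, k - 1, k, k + 1} \<Longrightarrow> poisson (b_fun lam k) (a_fun l) z = 0"
proof -
  assume l: "l \<notin> {k - 1, k + 1}"
  show "poisson (a_fun k) (a_fun l) z = 0"
  proof (cases "k = l")
    case False
    have "i \<notin> {k, k + 1} \<or> i \<notin> {l, l + 1}" for i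
      using l False by (auto simp: diff_eq_eq eq_diff_eq)
    then show ?thesis
      using partial_a_fun_zero[OF z] by (intro poisson_eq_zero) metis
  qed (simp add: poisson_def mult.commute)
  show "poisson (b_fun lam k) (b_fun lam l) z = 0"
  proof (cases "k = l")
    case False
    have "partial1 i (b_fun lam k) z * partial2 i (b_fun lam l) z
        - partial2 i (b_fun lam k) z * partial1 i (b_fun lam l) z = 0" for i
    proof (cases "i = k \<or> i = l")
      case True
      \<comment> \<open>The centre of either function lies outside the support of the other, as the
        indices are neither equal nor adjacent.\<close>
      then have "i \<notin> {k - 1, k, k + 1} \<or> i \<notin> {l - 1, l, l + 1}"
        using l False by (auto simp: diff_eq_eq eq_diff_eq)
      then show ?thesis using partial_b_fun_zero[OF z two, of i] by fastforce
    next
      case False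
      then obtain c d where
        "partial1 i (b_fun lam k) z = c * snd z $ i" "partial2 i (b_fun lam k) z = - c * fst z $ i"
        "partial1 i (b_fun lam l) z = d * snd z $ i" "partial2 i (b_fun lam l) z = - d * fst z $ i"
        using partial_b_fun_outer[OF z two] by metis
      then show ?thesis by simp
    qed
    then show ?thesis by (simp add: poisson_def)
  qed (simp add: poisson_def mult.commute)
next
  assume l: "l \<notin> {k - 2, k - 1, k, k + 1}"
  have "i \<notin> {k - 1, k, k + 1} \<or> i \<notin> {l, l + 1}" for i
  proof -
    \<comment> \<open>The right vector of \<open>a\<^sub>l\<close> meets the left outer vector of
      \<open>b\<^sub>k\<close> only at the excluded index \<open>k - 2\<close>.\<close>
    have "l = k - 2" if "l + 1 = k - 1"
      using that by (simp add: eq_diff_eq add.assoc)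
    then show ?thesis using l by (auto simp: eq_diff_eq)
  qed
  then show "poisson (b_fun lam k) (a_fun l) z = 0"
    using partial_a_fun_zero[OF z] partial_b_fun_zero[OF z two] by (intro poisson_eq_zero) metis
qed

text \<open>Stated in terms of \<open>b_fun lam k z + lam\<close>, the formulas are the cubic Toda
  brackets; expanding this shift later produces the other two. The indices are chosen so that only
  the four vectors from \<open>k - 1\<close> to \<open>k + 2\<close> occur.\<close>

lemma poisson_neighbours:
  fixes z :: "'i::{finite,comm_ring_1} pairs" and k :: 'i
  assumes z: "z \<in> regular_set" and two: "(2::'i) \<noteq> 0" and three: "(3::'i) \<noteq> 0"
  shows "poisson (a_fun (k - 1)) (a_fun k) z
      = - 2 * a_fun (k - 1) z * a_fun k z * (b_fun lam k z + lam)"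
    and "poisson (b_fun lam k) (b_fun lam (k + 1)) z
      = - a_fun k z * ((b_fun lam k z + lam) + (b_fun lam (k + 1) z + lam))"
    and "poisson (b_fun lam (k + 1)) (a_fun (k - 1)) z = a_fun (k - 1) z * a_fun k z"
    and "poisson (b_fun lam k) (a_fun (k - 1)) z
      = a_fun (k - 1) z * ((b_fun lam k z + lam)\<^sup>2 + a_fun (k - 1) z)"
    and "poisson (b_fun lam k) (a_fun k) z
      = - a_fun k z * ((b_fun lam k z + lam)\<^sup>2 + a_fun k z)"
    and "poisson (b_fun lam k) (a_fun (k + 1)) z = - a_fun k z * a_fun (k + 1) z"
proof -
  obtain x y where xy: "z = (x, y)" by (cases z)
  define p q r s where pqrs: "p = k - 1" "q = k" "r = k + 1" "s = k + 2"
  have idx: "p + 1 = q" "q + 1 = r" "r + 1 = s" "q - 1 = p" "r - 1 = q" "s - 1 = r"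
    by (simp_all add: pqrs add.assoc algebra_simps)
  \<comment> \<open>The ends of the four-vector window must not coincide; they differ by 3.\<close>
  have "k - 1 \<noteq> k + 2"
  proof
    assume "k - 1 = k + 2"
    then have "k = k + 3" by (simp add: diff_eq_eq add.assoc)
    then show False using three by simp
  qed
  moreover have "(2::'i) \<noteq> 1"
    by (metis add_cancel_right_right one_add_one one_neq_zero)
  ultimately have ne: "p \<noteq> q" "p \<noteq> r" "p \<noteq> s" "q \<noteq> r" "q \<noteq> s" "r \<noteq> s"
    using add_one_neq_diff_one[OF two, of k] two by (auto simp: pqrs diff_eq_eq eq_diff_eq)
  note ne' = ne ne[symmetric]
  define G H K where GHK: "G = g_fun p z" "H = g_fun q z" "K = g_fun r z"
  define A B C where ABC: "A = a_fun p z" "B = a_fun q z" "C = a_fun r z"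
  define V W where VW: "V = b_fun lam q z + lam" "W = b_fun lam r z + lam"
  have nz: "G \<noteq> 0" "H \<noteq> 0" "K \<noteq> 0"
    by (simp_all add: GHK g_fun_nonzero[OF z])
  have GHK_eq: "G = x $ p * y $ q - y $ p * x $ q" "H = x $ q * y $ r - y $ q * x $ r"
     "K = x $ r * y $ s - y $ r * x $ s"
    by (simp_all add: GHK g_fun_def xy idx)
  have ABC_eq: "A = 1 / G\<^sup>2" "B = 1 / H\<^sup>2" "C = 1 / K\<^sup>2"
    by (simp_all add: ABC GHK a_fun_eq)
  \<comment> \<open>The definition of \<open>b_fun\<close> solved for the determinants of vectors
    two apart, which removes the coordinates from the bracket formulas below.\<close>
  have u: "x $ p * y $ r - y $ p * x $ r = V * G * H" "x $ q * y $ s - y $ q * x $ s = W * H * K"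
    using nz by (simp_all add: VW GHK b_fun_add idx u_fun_def xy)
  have dA: "partial1 i (a_fun p) z = - 2 * (delta i p * y $ q - y $ p * delta i q) / G ^ 3"
    "partial2 i (a_fun p) z = - 2 * (x $ p * delta i q - delta i p * x $ q) / G ^ 3" for i
    using partial_a_fun[of p x y i] nz by (simp_all add: GHK xy idx)
  have dB: "partial1 i (a_fun q) z = - 2 * (delta i q * y $ r - y $ q * delta i r) / H ^ 3"
    "partial2 i (a_fun q) z = - 2 * (x $ q * delta i r - delta i q * x $ r) / H ^ 3" for i
    using partial_a_fun[of q x y i] nz by (simp_all add: GHK xy idx)
  have dC: "partial1 i (a_fun r) z = - 2 * (delta i r * y $ s - y $ r * delta i s) / K ^ 3"
    "partial2 i (a_fun r) z = - 2 * (x $ r * delta i s - delta i r * x $ s) / K ^ 3" for i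
    using partial_a_fun[of r x y i] nz by (simp_all add: GHK xy idx)
  have dV: "partial1 i (b_fun lam q) z = delta i r * B * y $ r - delta i p * A * y $ p
      + delta i q * V * (y $ p / G - y $ r / H)"
    "partial2 i (b_fun lam q) z = - delta i r * B * x $ r + delta i p * A * x $ p
      - delta i q * V * (x $ p / G - x $ r / H)" for i
    using partial_b_fun[of q x y i lam] nz two by (simp_all add: GHK ABC VW xy idx)
  have dW: "partial1 i (b_fun lam r) z = delta i s * C * y $ s - delta i q * B * y $ q
      + delta i r * W * (y $ q / H - y $ s / K)"
    "partial2 i (b_fun lam r) z = - delta i s * C * x $ s + delta i q * B * x $ q
      - delta i r * W * (x $ q / H - x $ s / K)" for i
    using partial_b_fun[of r x y i lam] nz two by (simp_all add: GHK ABC VW xy idx)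

  \<comment> \<open>Only \<open>r\<^sub>q\<close> is shared. Its two partners
    \<open>r\<^sub>p\<close> and \<open>r\<^sub>r\<close> form the determinant
    \<open>u\<^sub>q\<close>, hence the factor \<open>V\<close>.\<close>
  have "poisson (a_fun p) (a_fun q) z = - 2 * (x $ p * y $ r - y $ p * x $ r) / (G ^ 3 * H ^ 3)"
    by (subst poisson_eq_sum[of "{q}"]) (auto simp: dA dB ne' delta_def, simp add: nz field_simps)
  also have "\<dots> = - 2 * A * B * V"
    unfolding u ABC_eq using nz by (simp add: field_simps power_numeral_reduce)
  finally show "poisson (a_fun (k - 1)) (a_fun k) z
      = - 2 * a_fun (k - 1) z * a_fun k z * (b_fun lam k z + lam)"
    by (simp only: pqrs ABC VW)

  \<comment> \<open>Each of the two shared vectors is the centre of one function and outer for the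
    other: \<open>r\<^sub>q\<close> yields the \<open>V\<close> term and \<open>r\<^sub>r\<close>
    the \<open>W\<close> term, both with the outer factor \<open>B\<close>.\<close>
  have "poisson (b_fun lam q) (b_fun lam r) z
      = (B / 2) * (V * ((y $ p * x $ q - x $ p * y $ q) / G - (x $ q * y $ r - y $ q * x $ r) / H)
         + W * ((y $ q * x $ r - x $ q * y $ r) / H - (x $ r * y $ s - y $ r * x $ s) / K))"
    by (subst poisson_eq_sum[of "{q, r}"]) (auto simp: dV dW ne' delta_def, simp add: ne' algebra_simps diff_divide_distrib
        add_divide_distrib)
  also have "\<dots> = (B / 2) * (V * (- G / G - H / H) + W * (- H / H - K / K))"
    unfolding GHK_eq by (simp add: algebra_simps)
  also have "\<dots> = - B * (V + W)"
    using nz by (simp add: algebra_simps)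
  finally show "poisson (b_fun lam k) (b_fun lam (k + 1)) z
      = - a_fun k z * ((b_fun lam k z + lam) + (b_fun lam (k + 1) z + lam))"
    by (simp only: pqrs ABC VW)

  have "poisson (b_fun lam r) (a_fun p) z = B * (x $ p * y $ q - y $ p * x $ q) / G ^ 3"
    by (subst poisson_eq_sum[of "{q}"]) (auto simp: dA dW ne' delta_def, simp add: nz field_simps)
  also have "\<dots> = A * B"
    unfolding GHK_eq(1)[symmetric] ABC_eq using nz by (simp add: field_simps power_numeral_reduce)
  finally show "poisson (b_fun lam (k + 1)) (a_fun (k - 1)) z = a_fun (k - 1) z * a_fun k z"
    by (simp only: pqrs ABC VW)

  \<comment> \<open>The outer vector \<open>r\<^sub>p\<close> gives \<open>A\<^sup>2\<close>. At the
    centre \<open>r\<^sub>q\<close> the \<open>r\<^sub>p\<close> parts of the gradients are parallel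
    and cancel; the rest is \<open>V\<close> times a determinant again containing \<open>V\<close>,
    whence \<open>V\<^sup>2\<close>.\<close>
  have "poisson (b_fun lam q) (a_fun p) z
      = A * (x $ p * y $ q - y $ p * x $ q) / G ^ 3 + V * (x $ p * y $ r - y $ p * x $ r) / (G ^ 3 * H)"
    by (subst poisson_eq_sum[of "{p, q}"]) (auto simp: dA dV ne' delta_def, simp add: ne' nz field_simps)
  also have "\<dots> = A * (V\<^sup>2 + A)"
    unfolding GHK_eq(1)[symmetric] u ABC_eq using nz by (simp add: field_simps power_numeral_reduce)
  finally show "poisson (b_fun lam k) (a_fun (k - 1)) z
      = a_fun (k - 1) z * ((b_fun lam k z + lam)\<^sup>2 + a_fun (k - 1) z)"
    by (simp only: pqrs ABC VW)

  have "poisson (b_fun lam q) (a_fun q) z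
      = - (B * (x $ q * y $ r - y $ q * x $ r) / H ^ 3) - V * (x $ p * y $ r - y $ p * x $ r) / (G * H ^ 3)"
    by (subst poisson_eq_sum[of "{q, r}"]) (auto simp: dB dV ne' delta_def, simp add: ne' nz field_simps)
  also have "\<dots> = - B * (V\<^sup>2 + B)"
    unfolding GHK_eq(2)[symmetric] u ABC_eq using nz by (simp add: field_simps power_numeral_reduce)
  finally show "poisson (b_fun lam k) (a_fun k) z
      = - a_fun k z * ((b_fun lam k z + lam)\<^sup>2 + a_fun k z)"
    by (simp only: pqrs ABC VW)

  have "poisson (b_fun lam q) (a_fun r) z = - (B * (x $ r * y $ s - y $ r * x $ s) / K ^ 3)"
    by (subst poisson_eq_sum[of "{r}"]) (auto simp: dC dV ne' delta_def, simp add: nz field_simps)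
  also have "\<dots> = - B * C"
    unfolding GHK_eq(3)[symmetric] ABC_eq using nz by (simp add: field_simps power_numeral_reduce)
  finally show "poisson (b_fun lam k) (a_fun (k + 1)) z = - a_fun k z * a_fun (k + 1) z"
    by (simp only: pqrs ABC VW)
qed

section \<open>Specialisation to indices modulo \<open>N\<close> and comparison with the Toda
  brackets\<close>

lemma mod_ring_of_nat_nonzero:
  assumes "0 < m" "m < CARD('n)"
  shows "(of_nat m :: 'n::nontriv mod_ring) \<noteq> 0"
  using assms by (simp add: of_nat_eq_0_iff_char_dvd nat_dvd_not_less)

theorem theorem3p1:
  fixes N :: nat and lam :: real and z :: "'n::nontriv mod_ring pairs"
  assumes "N = CARD('n)" and "N > 3"
    and "z \<in> regular_set"
  shows
    "(\<forall>k. poisson (a_fun k) (a_fun (k + 1)) z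
          = - 2 * a_fun k z * a_fun (k + 1) z * b_fun lam (k + 1) z
            - 2 * a_fun k z * a_fun (k + 1) z * lam) \<and>
     (\<forall>k. poisson (b_fun lam k) (b_fun lam (k + 1)) z
          = - a_fun k z * (b_fun lam k z + b_fun lam (k + 1) z) - 2 * a_fun k z * lam) \<and>
     (\<forall>k. poisson (b_fun lam k) (a_fun (k - 2)) z = a_fun (k - 2) z * a_fun (k - 1) z) \<and>
     (\<forall>k. poisson (b_fun lam k) (a_fun (k - 1)) z
          = a_fun (k - 1) z * ((b_fun lam k z)\<^sup>2 + a_fun (k - 1) z)
            + 2 * b_fun lam k z * a_fun (k - 1) z * lam + a_fun (k - 1) z * lam\<^sup>2) \<and>
     (\<forall>k. poisson (b_fun lam k) (a_fun k) z
          = - a_fun k z * ((b_fun lam k z)\<^sup>2 + a_fun k z)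
            - 2 * b_fun lam k z * a_fun k z * lam - a_fun k z * lam\<^sup>2) \<and>
     (\<forall>k. poisson (b_fun lam k) (a_fun (k + 1)) z = - a_fun k z * a_fun (k + 1) z) \<and>
     (\<forall>k l. l \<notin> {k - 1, k + 1} \<longrightarrow> poisson (a_fun k) (a_fun l) z = 0) \<and>
     (\<forall>k l. l \<notin> {k - 1, k + 1} \<longrightarrow> poisson (b_fun lam k) (b_fun lam l) z = 0) \<and>
     (\<forall>k l. l \<notin> {k - 2, k - 1, k, k + 1} \<longrightarrow> poisson (b_fun lam k) (a_fun l) z = 0) \<and>
     (\<forall>F \<in> toda_generators. \<forall>H \<in> toda_generators.
        poisson (F \<circ> flaschka_map lam) (H \<circ> flaschka_map lam) z
          = toda_bracket3 F H (flaschka_map lam z)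
            + 2 * lam * toda_bracket2 F H (flaschka_map lam z)
            + lam\<^sup>2 * toda_bracket1 F H (flaschka_map lam z))"
proof (intro conjI allI impI ballI)
  \<comment> \<open>The bound \<open>N > 3\<close> enters as the statement that 2 and 3 are nonzero
    modulo \<open>N\<close>.\<close>
  have two: "(2 :: 'n mod_ring) \<noteq> 0" and three: "(3 :: 'n mod_ring) \<noteq> 0"
    using mod_ring_of_nat_nonzero[of 2, where 'n = 'n] mod_ring_of_nat_nonzero[of 3, where 'n = 'n]
      assms(1,2) by auto
  note nb = poisson_neighbours[OF assms(3) two three, where lam = lam]
  note nn = poisson_nonneighbours[OF assms(3) two]
  show aa: "poisson (a_fun k) (a_fun (k + 1)) z
          = - 2 * a_fun k z * a_fun (k + 1) z * b_fun lam (k + 1) z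
            - 2 * a_fun k z * a_fun (k + 1) z * lam" for k
    \<comment> \<open>The general formula is centred at the shared vector, so the index moves up by
      one.\<close>
    using nb(1)[of "k + 1"] by (simp add: algebra_simps)
  show bb: "poisson (b_fun lam k) (b_fun lam (k + 1)) z
          = - a_fun k z * (b_fun lam k z + b_fun lam (k + 1) z) - 2 * a_fun k z * lam" for k
    using nb(2)[of k] by (simp add: algebra_simps)
  show ba2: "poisson (b_fun lam k) (a_fun (k - 2)) z = a_fun (k - 2) z * a_fun (k - 1) z" for k
    using nb(3)[of "k - 1"] by (simp add: diff_diff_eq)
  show ba1: "poisson (b_fun lam k) (a_fun (k - 1)) z
          = a_fun (k - 1) z * ((b_fun lam k z)\<^sup>2 + a_fun (k - 1) z)
            + 2 * b_fun lam k z * a_fun (k - 1) z * lam + a_fun (k - 1) z * lam\<^sup>2" for k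
    using nb(4)[of k] by (simp add: algebra_simps power2_eq_square)
  show ba0: "poisson (b_fun lam k) (a_fun k) z
          = - a_fun k z * ((b_fun lam k z)\<^sup>2 + a_fun k z)
            - 2 * b_fun lam k z * a_fun k z * lam - a_fun k z * lam\<^sup>2" for k
    using nb(5)[of k] by (simp add: algebra_simps power2_eq_square)
  show bap: "poisson (b_fun lam k) (a_fun (k + 1)) z = - a_fun k z * a_fun (k + 1) z" for k
    by (rule nb(6))
  show aa0: "poisson (a_fun k) (a_fun l) z = 0" if "l \<notin> {k - 1, k + 1}" for k l
    using that by (rule nn(1))
  show bb0: "poisson (b_fun lam k) (b_fun lam l) z = 0" if "l \<notin> {k - 1, k + 1}" for k l
    using that by (rule nn(2))
  show ba00: "poisson (b_fun lam k) (a_fun l) z = 0" if "l \<notin> {k - 2, k - 1, k, k + 1}" for k l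
    using that by (rule nn(3))

  define w where "w = flaschka_map lam z"
  have w: "fst w $ k = a_fun k z" "snd w $ k = b_fun lam k z" for k
    by (simp_all add: w_def flaschka_map_def)
  \<comment> \<open>There is no \<open>lam\<^sup>2\<close> term here or in \<open>BB\<close>,
    because the linear bracket pairs only some \<open>b\<close> with some \<open>a\<close>.\<close>
  have AA: "poisson (a_fun k) (a_fun l) z = toda3_AA k l w + 2 * lam * toda2_AA k l w" for k l
  proof -
    consider "l = k + 1" | "l \<noteq> k + 1" "k = l + 1" | "l \<noteq> k + 1" "k \<noteq> l + 1" by blast
    then show ?thesis
    proof cases
      case 1
      then show ?thesis
        by (simp add: aa toda3_AA_def toda2_AA_def case_prod_beta w)
    next
      case 2
      then show ?thesis
        by (simp add: poisson_swap[of "a_fun (l + 1)"] aa toda3_AA_def toda2_AA_def case_prod_beta w)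
    next
      case 3
      then show ?thesis
        by (subst aa0) (auto simp: toda3_AA_def toda2_AA_def)
    qed
  qed
  have BB: "poisson (b_fun lam k) (b_fun lam l) z = toda3_BB k l w + 2 * lam * toda2_BB k l w" for k l
  proof -
    consider "l = k + 1" | "l \<noteq> k + 1" "k = l + 1" | "l \<noteq> k + 1" "k \<noteq> l + 1" by blast
    then show ?thesis
    proof cases
      case 1
      then show ?thesis
        by (simp add: bb toda3_BB_def toda2_BB_def case_prod_beta w)
    next
      case 2
      then show ?thesis
        by (simp add: poisson_swap[of "b_fun lam (l + 1)"] bb toda3_BB_def toda2_BB_def case_prod_beta w)
    next
      case 3
      then show ?thesis
        by (subst bb0) (auto simp: toda3_BB_def toda2_BB_def)
    qed
  qed
  have BA: "poisson (b_fun lam k) (a_fun l) z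
      = toda3_BA k l w + 2 * lam * toda2_BA k l w + lam\<^sup>2 * toda1_BA k l w" for k l
  proof -
    \<comment> \<open>The four listed indices are pairwise distinct, so the first matching branch of
      each table is the intended one.\<close>
    have "k - 1 \<noteq> k - 2" "k \<noteq> k - 2" "k + 1 \<noteq> k - 2"
      using two three by (auto simp: eq_diff_eq diff_eq_eq add.assoc)
    note ne = this this[symmetric] add_one_neq_diff_one[OF two, of k]
    consider "l = k - 2" | "l = k - 1" | "l = k" | "l = k + 1" | "l \<notin> {k - 2, k - 1, k, k + 1}"
      by blast
    then show ?thesis
      by cases (simp_all add: ne ba2 ba1 ba0 bap ba00 toda3_BA_def toda2_BA_def toda1_BA_def
          case_prod_beta w)
  qed
  fix F H :: "'n mod_ring pairs \<Rightarrow> real"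
  \<comment> \<open>Pulling the coordinate generators back along the Flaschka map gives
    \<open>a\<^sub>k\<close> and \<open>b\<^sub>k\<close>, so the tables \<open>AA\<close>,
    \<open>BB\<close> and \<open>BA\<close>, with antisymmetry for the pairs \<open>(a, b)\<close>,
    cover all generators.\<close>
  have comp: "a_coord k \<circ> flaschka_map lam = a_fun k" "b_coord k \<circ> flaschka_map lam = b_fun lam k"
    for k :: "'n mod_ring"
    by (simp_all add: fun_eq_iff a_coord_def b_coord_def flaschka_map_def)
  assume "F \<in> toda_generators" "H \<in> toda_generators"
  then show "poisson (F \<circ> flaschka_map lam) (H \<circ> flaschka_map lam) z
          = toda_bracket3 F H (flaschka_map lam z)
            + 2 * lam * toda_bracket2 F H (flaschka_map lam z)
            + lam\<^sup>2 * toda_bracket1 F H (flaschka_map lam z)"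
    unfolding toda_generators_def toda_bracket1_def toda_bracket2_def toda_bracket3_def
      w_def[symmetric]
    by (auto simp: comp bracket_of_table_coord AA BB BA poisson_swap[of "a_fun _" "b_fun _ _"])
qed

end
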